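(* For each $x$ let $d^*=d^*(x)$ be a prime difference champion for primes $\le x$. Then $d^*(x)\to\infty$ as $x\to\infty$, and the number of distinct prime factors of $d^*(x)$ also tends to infinity as $x\to\infty$.
   Context: For $x\ge 2$ and a positive integer $d$, let $G(x,d)$ be the number of pairs of primes $(p,p')$ with $p,p'\le x$ and $p'-p=d$. A prime difference champion for $x$ is any positive integer $d$ at which $G(x,d)$ attains its maximum over positive integers $d$. This result is unconditional. *)

theory Defs
  imports Complex_Main "HOL-Computational_Algebra.Primes"
begin

definition prime_diff_count :: "real \<Rightarrow> nat \<Rightarrow> nat" where
  "prime_diff_count x d =
     card {(p, p'). prime (p::nat) \<and> prime (p'::nat) \<and> real p \<le> x \<and> real p' \<le> x
                    \<and> int p' - int p = int d}"

definition prime_difference_champion :: "real \<Rightarrow> nat \<Rightarrow> bool" where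
  "prime_difference_champion x d \<longleftrightarrow>
     d > 0 \<and> (\<forall>d'>0. prime_diff_count x d' \<le> prime_diff_count x d)"

end

theory Submission
  imports Defs "HOL-Number_Theory.Totient" "HOL-Computational_Algebra.Squarefree"
    "HOL-Analysis.Harmonic_Numbers" "HOL-Real_Asymp.Real_Asymp"
begin

text \<open>
  Let \<open>N = \<lfloor>x\<rfloor>\<close>. If \<open>d\<close> has at most \<open>k\<close> prime factors, Selberg's sieve gives
  \<open>G(x,d) \<le> C\<^sub>k N / log\<^sup>2 N + 2 \<surd>N\<close>. On the other hand, the primes up to \<open>N\<close> not dividing \<open>P\<close> lie in
  \<open>\<phi>(P)\<close> residue classes modulo \<open>P\<close>, so by Cauchy--Schwarz and Chebyshev's bound there are about
  \<open>N\<^sup>2 / (\<phi>(P) log\<^sup>2 N)\<close> pairs of primes congruent modulo \<open>P\<close>. Their differences are among the at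
  most \<open>N / P\<close> multiples of \<open>P\<close>, so some \<open>d\<close> has \<open>G(x,d) \<ge> c (P / \<phi>(P)) N / log\<^sup>2 N\<close> with \<open>c\<close> absolute.
  As \<open>P / \<phi>(P)\<close> is unbounded, a champion has more than \<open>k\<close> prime factors once \<open>x\<close> is large.
\<close>

section \<open>A sieve for two residue classes\<close>

text \<open>By the Chinese remainder theorem \<open>n \<mapsto> (n mod a, n mod b)\<close> is a
  bijection onto the pairs of residues, so the double sum factors.\<close>

lemma sum_mult_coprime_periodic:
  fixes f g :: "nat \<Rightarrow> 'a :: comm_semiring_0"
  assumes "coprime a b" "a > 0" "b > 0"
    and f: "\<And>n. f (n mod a) = f n" and g: "\<And>n. g (n mod b) = g n"
  shows "(\<Sum>n<a * b. f n * g n) = (\<Sum>n<a. f n) * (\<Sum>n<b. g n)"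
proof -
  let ?h = "\<lambda>n. (n mod a, n mod b)"
  have inj: "inj_on ?h {..<a * b}"
  proof (rule inj_onI)
    fix x y assume xy: "x \<in> {..<a * b}" "y \<in> {..<a * b}" "?h x = ?h y"
    then have "[x = y] (mod a)" "[x = y] (mod b)"
      by (auto simp: Cong.cong_def)
    with \<open>coprime a b\<close> have "[x = y] (mod a * b)"
      by (simp add: coprime_cong_mult_nat)
    with xy show "x = y"
      by (auto simp: Cong.cong_def)
  qed
  have "?h ` {..<a * b} = {..<a} \<times> {..<b}"
  proof (rule card_subset_eq)
    show "card (?h ` {..<a * b}) = card ({..<a} \<times> {..<b})"
      by (simp add: card_image[OF inj])
  qed (use assms in auto)
  with inj have bij: "bij_betw ?h {..<a * b} ({..<a} \<times> {..<b})"
    by (simp add: bij_betw_def)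
  have "(\<Sum>n<a. f n) * (\<Sum>n<b. g n) = (\<Sum>(i, j)\<in>{..<a} \<times> {..<b}. f i * g j)"
    by (simp add: sum_product sum.cartesian_product)
  also have "\<dots> = (\<Sum>n<a * b. f n * g n)"
    using sum.reindex_bij_betw[OF bij, of "\<lambda>(i, j). f i * g j"] by (simp add: f g)
  finally show ?thesis ..
qed

lemma prod_mod_prod:
  fixes f :: "nat \<Rightarrow> nat \<Rightarrow> 'a :: comm_monoid_mult"
  assumes "Q \<subseteq> R" "finite R" and f: "\<And>p n. p \<in> Q \<Longrightarrow> f p (n mod p) = f p n"
  shows "(\<Prod>p\<in>Q. f p (n mod \<Prod>R)) = (\<Prod>p\<in>Q. f p n)"
proof (rule prod.cong)
  fix p assume p: "p \<in> Q"
  then have "p dvd \<Prod>R"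
    using assms by (intro dvd_prodI) auto
  have "f p (n mod \<Prod>R) = f p (n mod \<Prod>R mod p)"
    by (simp only: f[OF p])
  also have "\<dots> = f p n"
    using \<open>p dvd \<Prod>R\<close> by (simp add: mod_mod_cancel f[OF p])
  finally show "f p (n mod \<Prod>R) = f p n" .
qed simp

text \<open>The Chinese remainder theorem, applied one prime at a time, reduces a full-period sum to
  local sums modulo each prime.\<close>

lemma sum_prod_periodic:
  fixes f :: "nat \<Rightarrow> nat \<Rightarrow> 'a :: comm_semiring_1"
  assumes "finite Q" "\<And>p. p \<in> Q \<Longrightarrow> prime p" "\<And>p n. p \<in> Q \<Longrightarrow> f p (n mod p) = f p n"
  shows "(\<Sum>n<\<Prod>Q. \<Prod>p\<in>Q. f p n) = (\<Prod>p\<in>Q. \<Sum>n<p. f p n)"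
  using assms
proof (induction Q rule: finite_induct)
  case (insert q Q)
  have "coprime q (\<Prod>Q)"
    using insert by (intro prod_coprime_right) (metis insertCI primes_coprime)
  moreover have "\<Prod>Q > 0"
    using insert by (intro prod_pos) (auto intro: prime_gt_0_nat)
  moreover have "(\<Prod>p\<in>Q. f p (n mod \<Prod>Q)) = (\<Prod>p\<in>Q. f p n)" for n
    using insert by (intro prod_mod_prod) auto
  ultimately have "(\<Sum>n<q * \<Prod>Q. f q n * (\<Prod>p\<in>Q. f p n)) = (\<Sum>n<q. f q n) * (\<Sum>n<\<Prod>Q. \<Prod>p\<in>Q. f p n)"
    using insert by (intro sum_mult_coprime_periodic) (auto intro: prime_gt_0_nat)
  then show ?case
    using insert by simp
qed simp

text \<open>Complete periods are evaluated exactly; the incomplete one has fewer than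
  \<open>m\<close> terms, each at most 1. Nonnegativity of the period sum covers the fraction of a
  period that the main term counts in excess.\<close>

lemma sum_periodic_le:
  fixes F :: "nat \<Rightarrow> real"
  assumes "m > 0" and per: "\<And>n. F (n mod m) = F n" and le: "\<And>n. F n \<le> 1"
    and T: "0 \<le> (\<Sum>n<m. F n)"
  shows "(\<Sum>n<N. F n) \<le> real N / real m * (\<Sum>n<m. F n) + real m"
proof (induction N rule: less_induct)
  case (less N)
  show ?case
  proof (cases "N < m")
    case True
    have "(\<Sum>n<N. F n) \<le> (\<Sum>n<N. 1)"
      by (intro sum_mono le)
    also have "\<dots> \<le> real m"
      using True by simp
    also have "\<dots> \<le> real N / real m * (\<Sum>n<m. F n) + real m"
      using T by simp
    finally show ?thesis .
  next
    case False
    then obtain k where k: "N = m + k"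
      using le_Suc_ex not_less by blast
    have shift: "F (n + m) = F n" for n
      using per[of "n + m"] per[of n] by simp
    have "(\<Sum>n<N. F n) = (\<Sum>n<m. F n) + (\<Sum>n<k. F (n + m))"
      unfolding k by (induction k) (simp_all add: add_ac)
    also have "\<dots> = (\<Sum>n<m. F n) + (\<Sum>n<k. F n)"
      by (simp add: shift)
    also have "\<dots> \<le> (\<Sum>n<m. F n) + (real k / real m * (\<Sum>n<m. F n) + real m)"
      using less[of k] \<open>m > 0\<close> k by simp
    also have "\<dots> = real N / real m * (\<Sum>n<m. F n) + real m"
      using \<open>m > 0\<close> by (simp add: k field_simps)
    finally show ?thesis .
  qed
qed

text \<open>
  The weight modulo \<open>p\<close> is constant on the unsifted classes and has mean zero, so products over
  distinct sets of primes are orthogonal over a full period. The sum of these products over a family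
  of sets is a constant \<open>L\<close> on the sifted set, while its mean square is also close to \<open>L\<close>: this is
  Selberg's upper bound.
\<close>

definition sieve_weight :: "nat \<Rightarrow> nat \<Rightarrow> nat \<Rightarrow> real" where
  "sieve_weight d p n = (if p dvd n \<or> p dvd n + d then - 1 else 2 / (real p - 2))"

lemma sieve_weight_mod: "sieve_weight d p (n mod p) = sieve_weight d p n"
proof -
  have "p dvd n mod p + d \<longleftrightarrow> p dvd n + d"
    by (simp add: dvd_eq_mod_eq_0 mod_simps)
  then show ?thesis
    by (simp add: sieve_weight_def dvd_mod_iff)
qed

text \<open>The two classes are 0 and \<open>- d\<close> modulo \<open>p\<close>; they differ
  because \<open>p\<close> does not divide \<open>d\<close>.\<close>

lemma card_two_classes:
  fixes p d :: nat
  assumes "prime p" "\<not> p dvd d"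
  shows "card {n \<in> {..<p}. p dvd n \<or> p dvd n + d} = 2"
proof -
  have p: "p > 0" and d: "0 < d mod p" "d mod p < p"
    using assms by (auto simp: prime_gt_0_nat dvd_eq_mod_eq_0)
  have *: "p dvd n + d \<longleftrightarrow> n = p - d mod p" if "n < p" for n
  proof -
    have "p dvd n + d \<longleftrightarrow> p dvd n + d mod p"
      by (simp add: dvd_eq_mod_eq_0 mod_simps)
    also have "\<dots> \<longleftrightarrow> n + d mod p = p"
    proof
      \<comment> \<open>Since \<open>n + d mod p\<close> lies strictly between 0 and
        \<open>2 * p\<close>, the only multiple of \<open>p\<close> it can be is \<open>p\<close>
        itself.\<close>
      assume "p dvd n + d mod p"
      then obtain k where k: "n + d mod p = p * k" by auto
      have "0 < p * k" "p * k < p * 2"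
        using that d k by linarith+
      then have "k = 1" by auto
      with k show "n + d mod p = p" by simp
    qed simp
    also have "\<dots> \<longleftrightarrow> n = p - d mod p"
      using d by auto
    finally show ?thesis .
  qed
  have "p dvd n \<longleftrightarrow> n = 0" if "n < p" for n
    using that by (auto dest: dvd_imp_le)
  moreover have "p - d mod p < p"
    using d by linarith
  ultimately have "{n \<in> {..<p}. p dvd n \<or> p dvd n + d} = {0, p - d mod p}"
    using * p by blast
  with d show ?thesis by simp
qed

lemma sum_two_classes:
  fixes p d :: nat and a b :: real
  assumes "prime p" "\<not> p dvd d"
  shows "(\<Sum>n<p. if p dvd n \<or> p dvd n + d then a else b) = 2 * a + (real p - 2) * b"
proof -
  let ?B = "{n \<in> {..<p}. p dvd n \<or> p dvd n + d}"
  have eq: "{..<p} \<inter> - {n. p dvd n \<or> p dvd n + d} = {..<p} - ?B"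
    "{..<p} \<inter> {n. p dvd n \<or> p dvd n + d} = ?B" by auto
  have "card ({..<p} - ?B) = p - 2"
    using card_two_classes[OF assms] by (subst card_Diff_subset) auto
  moreover have "p \<ge> 2"
    using assms prime_ge_2_nat by blast
  ultimately show ?thesis
    using card_two_classes[OF assms] by (simp add: sum.If_cases eq of_nat_diff)
qed

lemma sum_sieve_weight:
  assumes "prime p" "\<not> p dvd d" "p > 2"
  shows "(\<Sum>n<p. sieve_weight d p n) = 0"
proof -
  have "(real p - 2) * (2 / (real p - 2)) = 2"
    using assms by (simp add: divide_simps)
  then show ?thesis
    by (simp add: sieve_weight_def sum_two_classes[OF assms(1,2)] del: times_divide_eq_right)
qed

text \<open>Two classes contribute 1 each and the other \<open>p - 2\<close> contribute
  \<open>4 / (p - 2)\<close> in total. The mean square thus equals the value of the weight on the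
  unsifted classes, which is why the same \<open>L\<close> appears on both sides of the sieve
  inequality.\<close>

lemma sum_sieve_weight_square:
  assumes "prime p" "\<not> p dvd d" "p > 2"
  shows "(\<Sum>n<p. (sieve_weight d p n)\<^sup>2) = real p * (2 / (real p - 2))"
proof -
  have "(sieve_weight d p n)\<^sup>2 = (if p dvd n \<or> p dvd n + d then 1 else (2 / (real p - 2))\<^sup>2)" for n
    by (simp add: sieve_weight_def)
  then have "(\<Sum>n<p. (sieve_weight d p n)\<^sup>2) = 2 * 1 + (real p - 2) * (2 / (real p - 2))\<^sup>2"
    by (simp only: sum_two_classes[OF assms(1,2)])
  also have "(2 / (real p - 2))\<^sup>2 = 4 / ((real p - 2) * (real p - 2))"
    by (simp add: power2_eq_square)
  also have "2 * 1 + (real p - 2) * \<dots> = real p * (2 / (real p - 2))"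
    using assms by (simp add: divide_simps) (simp add: algebra_simps)
  finally show ?thesis .
qed

text \<open>The prime 3 is excluded because there the weight takes the value 2.\<close>

lemma abs_sieve_weight_le: "p > 3 \<Longrightarrow> \<bar>sieve_weight d p n\<bar> \<le> 1"
  by (auto simp: sieve_weight_def)

text \<open>The product is periodic modulo \<open>\<Prod>(Q \<union> R)\<close>. A prime in only one
  of the sets has local sum 0 and kills the main term; for \<open>Q = R\<close> the local mean
  squares multiply. The error is at most one period.\<close>

lemma sum_sieve_weight_products:
  assumes fin: "finite Q" "finite R"
    and QR: "\<And>p. p \<in> Q \<union> R \<Longrightarrow> prime p \<and> p > 3 \<and> \<not> p dvd d"
    and z: "\<Prod>Q \<le> z" "\<Prod>R \<le> z"
  shows "(\<Sum>n<N. (\<Prod>p\<in>Q. sieve_weight d p n) * (\<Prod>p\<in>R. sieve_weight d p n))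
           \<le> (if Q = R then real N * (\<Prod>p\<in>Q. 2 / (real p - 2)) else 0) + (real z)\<^sup>2"
proof -
  \<comment> \<open>Primes common to both sets occur squared, which turns the two products into a
    single one over \<open>Q \<union> R\<close>.\<close>
  define w where "w p n = (if p \<in> Q \<inter> R then (sieve_weight d p n)\<^sup>2 else sieve_weight d p n)" for p n
  define F where "F n = (\<Prod>p\<in>Q \<union> R. w p n)" for n
  let ?m = "\<Prod>(Q \<union> R)"
  have prod_eq: "(\<Prod>p\<in>Q. sieve_weight d p n) * (\<Prod>p\<in>R. sieve_weight d p n) = F n" for n
  proof -
    have "(\<Prod>p\<in>Q. sieve_weight d p n) = (\<Prod>p\<in>Q \<union> R. if p \<in> Q then sieve_weight d p n else 1)"
      "(\<Prod>p\<in>R. sieve_weight d p n) = (\<Prod>p\<in>Q \<union> R. if p \<in> R then sieve_weight d p n else 1)"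
      using fin by (auto intro!: prod.mono_neutral_cong_left)
    then have "(\<Prod>p\<in>Q. sieve_weight d p n) * (\<Prod>p\<in>R. sieve_weight d p n) =
      (\<Prod>p\<in>Q \<union> R. (if p \<in> Q then sieve_weight d p n else 1) * (if p \<in> R then sieve_weight d p n else 1))"
      by (simp only: prod.distrib)
    also have "\<dots> = F n"
      unfolding F_def w_def by (intro prod.cong) (auto simp: power2_eq_square)
    finally show ?thesis .
  qed
  have w_mod: "w p (n mod p) = w p n" for p n
    by (simp add: w_def sieve_weight_mod)
  have w_le: "\<bar>w p n\<bar> \<le> 1" if "p \<in> Q \<union> R" for p n
    using abs_sieve_weight_le[of p d n] QR[OF that] by (auto simp: w_def abs_square_le_1)
  have F_mod: "F (n mod ?m) = F n" for n
    unfolding F_def using fin by (intro prod_mod_prod) (auto simp: w_mod)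
  have F_le: "F n \<le> 1" for n
  proof -
    have "\<bar>F n\<bar> \<le> 1"
      unfolding F_def abs_prod using w_le by (intro prod_le_1) auto
    then show ?thesis by simp
  qed
  have m: "?m > 0"
    using QR by (intro prod_pos) (auto intro: prime_gt_0_nat)
  have sumF: "(\<Sum>n<?m. F n) = (\<Prod>p\<in>Q \<union> R. \<Sum>n<p. w p n)"
    unfolding F_def using QR fin w_mod by (intro sum_prod_periodic) auto
  have sumF': "(\<Sum>n<?m. F n) = (if Q = R then real ?m * (\<Prod>p\<in>Q. 2 / (real p - 2)) else 0)"
  proof (cases "Q = R")
    case True
    have "(\<Prod>p\<in>Q. \<Sum>n<p. w p n) = (\<Prod>p\<in>Q. real p * (2 / (real p - 2)))"
    proof (intro prod.cong refl)
      fix p assume "p \<in> Q"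
      then show "(\<Sum>n<p. w p n) = real p * (2 / (real p - 2))"
        using True QR[of p] sum_sieve_weight_square[of p d] by (simp add: w_def)
    qed
    with True sumF show ?thesis
      by (simp only: Un_absorb prod.distrib of_nat_prod simp_thms if_True)
  next
    case False
    then obtain p where p: "p \<in> Q \<union> R" "p \<notin> Q \<inter> R" by blast
    then have "(\<Sum>n<p. w p n) = 0"
      using QR[of p] sum_sieve_weight[of p d] by (auto simp: w_def)
    with p fin False sumF show ?thesis
      by (auto simp: prod_zero_iff)
  qed
  have nonneg: "0 \<le> (\<Sum>n<?m. F n)"
    unfolding sumF' using QR by (auto intro!: mult_nonneg_nonneg prod_nonneg divide_nonneg_nonneg) force
  \<comment> \<open>Inserting the common primes a second time bounds the period by
    \<open>\<Prod>Q * \<Prod>R\<close>.\<close>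
  have "?m \<le> ?m * \<Prod>(Q \<inter> R)"
  proof -
    have "\<Prod>(Q \<inter> R) > 0"
      using QR by (intro prod_pos) (auto intro: prime_gt_0_nat)
    then show ?thesis by simp
  qed
  also have "\<dots> = \<Prod>Q * \<Prod>R"
    using fin by (rule prod.union_inter)
  also have "\<dots> \<le> z * z"
    using z by (intro mult_mono) auto
  finally have "real ?m \<le> (real z)\<^sup>2"
    by (metis of_nat_le_iff of_nat_power power2_eq_square)
  moreover have "(\<Sum>n<N. F n) \<le> real N / real ?m * (\<Sum>n<?m. F n) + real ?m"
    by (intro sum_periodic_le m F_mod F_le nonneg)
  moreover have "real N / real ?m * (\<Sum>n<?m. F n) =
      (if Q = R then real N * (\<Prod>p\<in>Q. 2 / (real p - 2)) else 0)"
    unfolding sumF' using m by (auto simp del: of_nat_prod)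
  ultimately show ?thesis
    by (simp only: prod_eq)
qed

text \<open>After the square is expanded, the diagonal pairs give \<open>N * L\<close> and each of
  the \<open>(card \<Q>)\<^sup>2\<close> pairs costs an error of at most
  \<open>z\<^sup>2\<close>.\<close>

lemma selberg_sieve_two_classes:
  assumes fin: "finite \<Q>" and Q: "\<And>Q. Q \<in> \<Q> \<Longrightarrow> finite Q \<and> \<Prod>Q \<le> z"
    and P: "\<And>Q p. Q \<in> \<Q> \<Longrightarrow> p \<in> Q \<Longrightarrow> prime p \<and> p > 3 \<and> \<not> p dvd d"
    and A: "A \<subseteq> {..<N}" "\<And>Q p n. Q \<in> \<Q> \<Longrightarrow> p \<in> Q \<Longrightarrow> n \<in> A \<Longrightarrow> \<not> p dvd n \<and> \<not> p dvd n + d"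
    and L: "L = (\<Sum>Q\<in>\<Q>. \<Prod>p\<in>Q. 2 / (real p - 2))"
  shows "real (card A) * L\<^sup>2 \<le> real N * L + (real (card \<Q>) * real z)\<^sup>2"
proof -
  define U where "U Q n = (\<Prod>p\<in>Q. sieve_weight d p n)" for Q n
  have "U Q n = (\<Prod>p\<in>Q. 2 / (real p - 2))" if "Q \<in> \<Q>" "n \<in> A" for Q n
    unfolding U_def using A(2)[OF that(1) _ that(2)] by (intro prod.cong) (auto simp: sieve_weight_def)
  then have UA: "(\<Sum>Q\<in>\<Q>. U Q n) = L" if "n \<in> A" for n
    unfolding L using that by (intro sum.cong) auto
  have "real (card A) * L\<^sup>2 = (\<Sum>n\<in>A. (\<Sum>Q\<in>\<Q>. U Q n)\<^sup>2)"
    by (simp add: UA)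
  \<comment> \<open>Extending the range from \<open>A\<close> to all \<open>n < N\<close> only adds
    squares.\<close>
  also have "\<dots> \<le> (\<Sum>n<N. (\<Sum>Q\<in>\<Q>. U Q n)\<^sup>2)"
    using A(1) by (intro sum_mono2) auto
  also have "\<dots> = (\<Sum>n<N. \<Sum>Q\<in>\<Q>. \<Sum>R\<in>\<Q>. U Q n * U R n)"
    by (simp add: power2_eq_square sum_product)
  also have "\<dots> = (\<Sum>Q\<in>\<Q>. \<Sum>R\<in>\<Q>. \<Sum>n<N. U Q n * U R n)"
    by (subst sum.swap, intro sum.cong refl, rule sum.swap)
  also have "\<dots> \<le> (\<Sum>Q\<in>\<Q>. \<Sum>R\<in>\<Q>. (if Q = R then real N * (\<Prod>p\<in>Q. 2 / (real p - 2)) else 0) + (real z)\<^sup>2)"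
  proof (intro sum_mono)
    fix Q R assume QR: "Q \<in> \<Q>" "R \<in> \<Q>"
    show "(\<Sum>n<N. U Q n * U R n) \<le> (if Q = R then real N * (\<Prod>p\<in>Q. 2 / (real p - 2)) else 0) + (real z)\<^sup>2"
      unfolding U_def using Q[OF QR(1)] Q[OF QR(2)] P QR by (intro sum_sieve_weight_products) auto
  qed
  also have "\<dots> = real N * L + (real (card \<Q>) * real z)\<^sup>2"
    using fin by (simp add: sum.distrib L sum_distrib_left power2_eq_square)
  finally show ?thesis .
qed

section \<open>Reciprocal sums over squarefree numbers\<close>

text \<open>A squarefree number up to \<open>y\<close> with no prime factor in \<open>R\<close> is
  encoded by its set of prime factors. Finiteness rules out infinite sets, whose product is 1 by
  default.\<close>

definition prime_sets :: "nat set \<Rightarrow> nat \<Rightarrow> nat set set" where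
  "prime_sets R y = {Q. finite Q \<and> (\<forall>p\<in>Q. prime p \<and> p \<notin> R) \<and> \<Prod>Q \<le> y}"

lemma prod_primes_pos: "(\<And>p. p \<in> Q \<Longrightarrow> prime p) \<Longrightarrow> \<Prod>Q > (0 :: nat)"
  by (intro prod_pos) (auto intro: prime_gt_0_nat)

lemma prime_factors_prod_primes:
  fixes Q :: "nat set"
  assumes "finite Q" "\<And>p. p \<in> Q \<Longrightarrow> prime p"
  shows "prime_factors (\<Prod>Q) = Q"
proof -
  have "prime_factors (\<Prod>Q) = (\<Union>p\<in>Q. prime_factors p)"
    using assms by (subst prime_factors_prod) force+
  also have "\<dots> = (\<Union>p\<in>Q. {p})"
    using assms by (intro SUP_cong refl prime_prime_factors) auto
  finally show ?thesis by simp
qed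

lemma inj_on_Prod_prime_sets: "inj_on \<Prod> (prime_sets R y)"
  by (rule inj_on_inverseI[of _ prime_factors]) (auto simp: prime_sets_def prime_factors_prod_primes)

lemma Prod_prime_sets_subset: "\<Prod> ` prime_sets R y \<subseteq> {1..y}"
proof
  fix n assume "n \<in> \<Prod> ` prime_sets R y"
  then obtain Q where "n = \<Prod>Q" "Q \<in> prime_sets R y" by auto
  then show "n \<in> {1..y}"
    using prod_primes_pos[of Q] by (auto simp: prime_sets_def Suc_le_eq simp del: prod_pos_nat_iff)
qed

lemma finite_prime_sets: "finite (prime_sets R y)"
  using inj_on_finite[OF inj_on_Prod_prime_sets Prod_prime_sets_subset] by simp

lemma card_prime_sets_le: "card (prime_sets R y) \<le> y"
  using card_inj_on_le[OF inj_on_Prod_prime_sets Prod_prime_sets_subset] by simp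

lemma prod_prime_factors_squarefree:
  fixes n :: nat
  assumes "squarefree n"
  shows "\<Prod>(prime_factors n) = n"
proof -
  have n: "n \<noteq> 0"
    using assms by (intro notI) simp
  have "\<Prod>(prime_factors n) = (\<Prod>p\<in>prime_factors n. p ^ multiplicity p n)"
    using squarefree_factorial_semiring'[OF n] assms by (intro prod.cong) auto
  also have "\<dots> = n"
    using prod_prime_factors[OF n] by simp
  finally show ?thesis .
qed

lemma sum_inverse_squares_le: "(\<Sum>m=1..n. 1 / (real m)\<^sup>2) \<le> 2"
proof -
  \<comment> \<open>The sharper bound makes the induction telescope.\<close>
  have "(\<Sum>m=1..Suc k. 1 / (real m)\<^sup>2) \<le> 2 - 1 / real (Suc k)" for k
  proof (induction k)
    case (Suc k)
    have "1 / (real (Suc (Suc k)))\<^sup>2 \<le> 1 / real (Suc k) - 1 / real (Suc (Suc k))"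
      by (simp add: divide_simps power2_eq_square)
    with Suc show ?case by simp
  qed simp
  moreover have "2 - 1 / real (Suc k) \<le> 2" for k
    by simp
  ultimately have "(\<Sum>m=1..Suc k. 1 / (real m)\<^sup>2) \<le> 2" for k
    using order_trans by blast
  then show ?thesis
    by (cases n) simp_all
qed

text \<open>
  Every \<open>n \<le> y\<close> factors uniquely as \<open>\<Prod>A * \<Prod>B * m\<^sup>2\<close> with \<open>A\<close> a set of primes outside \<open>R\<close> and \<open>B \<subseteq> R\<close>.
\<close>

lemma harm_le_sum_prime_sets:
  assumes "finite R"
  shows "harm y \<le> 2 * 2 ^ card R * (\<Sum>A\<in>prime_sets R y. 1 / real (\<Prod>A))"
proof -
  define f where "f n = (prime_factors (squarefree_part n) - R, prime_factors (squarefree_part n) \<inter> R, square_part n)"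
    for n :: nat
  define g :: "nat set \<times> nat set \<times> nat \<Rightarrow> real" where "g = (\<lambda>(A, B, m). 1 / real (\<Prod>A) * (1 / (real m)\<^sup>2))"
  define T where "T = prime_sets R y \<times> Pow R \<times> {1..y}"
  have split: "n = \<Prod>(prime_factors (squarefree_part n) - R) *
      \<Prod>(prime_factors (squarefree_part n) \<inter> R) * (square_part n)\<^sup>2" for n :: nat
  proof -
    have "\<Prod>(prime_factors (squarefree_part n) - R) * \<Prod>(prime_factors (squarefree_part n) \<inter> R)
        = \<Prod>(prime_factors (squarefree_part n))"
      by (subst prod.union_disjoint[symmetric]) (auto intro: arg_cong[where f = "\<Prod>"])
    also have "\<dots> = squarefree_part n"
      by (intro prod_prime_factors_squarefree) auto
    finally show ?thesis
      using squarefree_decompose[of n] by simp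
  qed
  have inj: "inj_on f {1..y}"
  proof (rule inj_onI)
    fix a b assume "f a = f b"
    then show "a = b"
      using split[of a] split[of b] by (auto simp: f_def)
  qed
  have f_in: "f n \<in> T" and le: "1 / real n \<le> g (f n)" if n: "n \<in> {1..y}" for n
  proof -
    let ?A = "prime_factors (squarefree_part n) - R" and ?B = "prime_factors (squarefree_part n) \<inter> R"
    let ?m = "square_part n"
    have pos: "\<Prod>?A > 0" "\<Prod>?B > 0" "?m > 0"
      using n by (auto intro!: prod_primes_pos Nat.gr0I)
    have "\<Prod>?A \<le> n"
      using pos n by (intro dvd_imp_le) (subst (2) split[of n], auto)
    moreover have "?m \<le> n"
      using pos n by (intro dvd_imp_le) (subst (2) split[of n], auto simp: power2_eq_square)
    ultimately show "f n \<in> T"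
      using n pos by (auto simp: T_def f_def prime_sets_def)
    have "real n = real (\<Prod>?A) * (real ?m)\<^sup>2 * real (\<Prod>?B)"
      by (subst split[of n]) (simp del: of_nat_prod)
    moreover have "real (\<Prod>?A) * (real ?m)\<^sup>2 * real (\<Prod>?B) \<ge> real (\<Prod>?A) * (real ?m)\<^sup>2 * 1"
      using pos by (intro mult_left_mono) (auto simp: Suc_le_eq simp del: of_nat_prod prod_pos_nat_iff)
    ultimately have "real n \<ge> real (\<Prod>?A) * (real ?m)\<^sup>2"
      by linarith
    moreover have "real (\<Prod>?A) * (real ?m)\<^sup>2 > 0"
      using pos by (intro mult_pos_pos zero_less_power) (simp_all del: of_nat_prod prod_pos_nat_iff)
    ultimately have "1 / real n \<le> 1 / (real (\<Prod>?A) * (real ?m)\<^sup>2)"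
      by (intro divide_left_mono) (simp_all del: of_nat_prod)
    then show "1 / real n \<le> g (f n)"
      by (simp add: g_def f_def)
  qed
  define V where "V = (\<Sum>m=1..y. 1 / (real m)\<^sup>2)"
  have finT: "finite T"
    using assms by (simp add: T_def finite_prime_sets)
  have "harm y = (\<Sum>n=1..y. 1 / real n)"
    by (simp add: harm_def divide_inverse)
  also have "\<dots> \<le> (\<Sum>n=1..y. g (f n))"
    by (intro sum_mono le)
  also have "\<dots> = (\<Sum>t\<in>f ` {1..y}. g t)"
    using sum.reindex[OF inj, of g] by simp
  also have "\<dots> \<le> (\<Sum>t\<in>T. g t)"
    using f_in by (intro sum_mono2 finT) (auto simp: g_def split: prod.splits intro!: mult_nonneg_nonneg prod_nonneg)
  also have "\<dots> = (\<Sum>A\<in>prime_sets R y. \<Sum>B\<in>Pow R. \<Sum>m\<in>{1..y}. 1 / real (\<Prod>A) * (1 / (real m)\<^sup>2))"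
    unfolding T_def g_def by (simp only: sum.cartesian_product split_def fst_conv snd_conv)
  \<comment> \<open>Since \<open>g\<close> ignores \<open>B\<close>, the sum over subsets of
    \<open>R\<close> gives the factor \<open>2 ^ card R\<close>; the sum over \<open>m\<close> is at
    most 2.\<close>
  also have "\<dots> = (\<Sum>A\<in>prime_sets R y. 2 ^ card R * (1 / real (\<Prod>A) * V))"
    unfolding V_def
    by (intro sum.cong refl)
      (simp only: sum_distrib_left[symmetric] sum_constant card_Pow[OF assms] of_nat_power of_nat_numeral mult.left_commute)
  also have "\<dots> = 2 ^ card R * V * (\<Sum>A\<in>prime_sets R y. 1 / real (\<Prod>A))"
    by (simp add: sum_distrib_left mult_ac del: of_nat_prod)
  also have "\<dots> \<le> 2 ^ card R * 2 * (\<Sum>A\<in>prime_sets R y. 1 / real (\<Prod>A))"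
    unfolding V_def by (intro mult_right_mono mult_left_mono sum_inverse_squares_le sum_nonneg) (auto intro!: prod_nonneg)
  finally show ?thesis by (simp add: mult_ac)
qed

text \<open>Each \<open>p\<close> in \<open>Q\<close> lies in \<open>A\<close> only, in
  \<open>B\<close> only, or in both, giving \<open>f p + f p + f p * f p\<close>. For fixed
  \<open>A\<close> one writes \<open>B = (Q - A) \<union> C\<close> with
  \<open>C \<subseteq> A\<close>, hence the grouping \<open>f p * (1 + f p)\<close> for
  \<open>p\<close> in \<open>A\<close> and \<open>f p\<close> otherwise.\<close>

lemma sum_pairs_union_eq:
  fixes f :: "'a \<Rightarrow> 'b :: comm_semiring_1"
  assumes "finite Q"
  shows "(\<Sum>(A, B) | A \<union> B = Q. prod f A * prod f B) = (\<Prod>p\<in>Q. f p * (1 + f p) + f p)"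
proof -
  have "(\<Sum>(A, B) | A \<union> B = Q. prod f A * prod f B)
      = (\<Sum>(A, C)\<in>(SIGMA A:Pow Q. Pow A). prod f A * prod f C * prod f (Q - A))"
  proof (rule sum.reindex_bij_witness[of _ "\<lambda>(A, C). (A, (Q - A) \<union> C)" "\<lambda>(A, B). (A, A \<inter> B)"], safe)
    fix A B assume Q: "Q = A \<union> B"
    have "B = (A \<inter> B) \<union> ((A \<union> B) - A)" by blast
    then have "prod f B = prod f ((A \<inter> B) \<union> ((A \<union> B) - A))" by simp
    also have "\<dots> = prod f (A \<inter> B) * prod f ((A \<union> B) - A)"
      using assms Q by (intro prod.union_disjoint) auto
    finally show "prod f A * prod f (A \<inter> B) * prod f (A \<union> B - A) = prod f A * prod f B"
      by (simp add: mult_ac)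
  qed auto
  also have "\<dots> = (\<Sum>A\<in>Pow Q. \<Sum>C\<in>Pow A. prod f A * prod f C * prod f (Q - A))"
    using assms by (subst sum.Sigma) (auto intro: finite_subset)
  also have "\<dots> = (\<Sum>A\<in>Pow Q. (\<Prod>p\<in>A. f p * (1 + f p)) * prod f (Q - A))"
  proof (intro sum.cong refl)
    fix A assume "A \<in> Pow Q"
    then have "finite A"
      using assms finite_subset by blast
    then have "(\<Prod>p\<in>A. f p + 1) = (\<Sum>C\<in>Pow A. prod f C)"
      by (simp add: prod_add)
    then show "(\<Sum>C\<in>Pow A. prod f A * prod f C * prod f (Q - A)) = (\<Prod>p\<in>A. f p * (1 + f p)) * prod f (Q - A)"
      by (simp add: prod.distrib sum_distrib_left sum_distrib_right add.commute)
  qed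
  also have "\<dots> = (\<Prod>p\<in>Q. f p * (1 + f p) + f p)"
    using assms by (rule prod_add[symmetric])
  finally show ?thesis .
qed

text \<open>This bounds the sieve's \<open>L\<close> from below by the square of a reciprocal sum.
  Pairs are grouped by their union, whose product is at most \<open>y * y\<close>, and the local
  factor \<open>2 / p + 1 / p\<^sup>2\<close> is at most \<open>2 / (p - 2)\<close>. The prime 2
  must be in \<open>R\<close>, as \<open>2 / (p - 2)\<close> is 0 there by convention.\<close>

lemma sum_prime_sets_square_le:
  assumes R: "2 \<in> R"
  shows "(\<Sum>A\<in>prime_sets R y. 1 / real (\<Prod>A))\<^sup>2
           \<le> (\<Sum>Q\<in>prime_sets R (y * y). \<Prod>p\<in>Q. 2 / (real p - 2))"
proof -
  define f :: "nat \<Rightarrow> real" where "f p = 1 / real p" for p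
  define T where "T = prime_sets R y \<times> prime_sets R y"
  have f: "1 / real (\<Prod>A) = prod f A" for A
    by (simp add: f_def prod_dividef)
  have f0: "prod f A \<ge> 0" for A
    by (intro prod_nonneg) (auto simp: f_def)
  have "(\<Sum>A\<in>prime_sets R y. 1 / real (\<Prod>A))\<^sup>2 = (\<Sum>(A, B)\<in>T. prod f A * prod f B)"
    by (simp add: f power2_eq_square sum_product sum.cartesian_product T_def del: of_nat_prod)
  also have "\<dots> = (\<Sum>Q\<in>prime_sets R (y * y). \<Sum>(A, B) | (A, B) \<in> T \<and> A \<union> B = Q. prod f A * prod f B)"
  proof -
    have sub: "(\<lambda>(A, B). A \<union> B) ` T \<subseteq> prime_sets R (y * y)"
    proof (clarsimp simp: T_def)
      fix A B assume AB: "A \<in> prime_sets R y" "B \<in> prime_sets R y"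
      then have fin: "finite A" "finite B" and le: "\<Prod>A \<le> y" "\<Prod>B \<le> y"
        and pr: "\<And>p. p \<in> A \<union> B \<Longrightarrow> prime p \<and> p \<notin> R"
        by (auto simp: prime_sets_def)
      have "\<Prod>(A \<inter> B) > 0"
        using pr by (intro prod_primes_pos) auto
      then have "\<Prod>(A \<union> B) \<le> \<Prod>(A \<union> B) * \<Prod>(A \<inter> B)" by simp
      also have "\<dots> = \<Prod>A * \<Prod>B"
        using fin by (rule prod.union_inter)
      also have "\<dots> \<le> y * y"
        using le by (intro mult_mono) auto
      finally show "A \<union> B \<in> prime_sets R (y * y)"
        using fin pr by (auto simp: prime_sets_def)
    qed
    have "finite T"
      by (simp add: T_def finite_prime_sets)
    from sum.group[OF this finite_prime_sets sub, of "\<lambda>(A, B). prod f A * prod f B"]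
    show ?thesis
      by (simp add: split_def)
  qed
  also have "\<dots> \<le> (\<Sum>Q\<in>prime_sets R (y * y). \<Sum>(A, B) | A \<union> B = Q. prod f A * prod f B)"
  proof (intro sum_mono sum_mono2)
    fix Q assume "Q \<in> prime_sets R (y * y)"
    then have "finite (Pow Q \<times> Pow Q)"
      by (auto simp: prime_sets_def)
    then show "finite {(A, B). A \<union> B = Q}"
      by (rule finite_subset[rotated]) auto
  qed (auto simp: f0)
  also have "\<dots> = (\<Sum>Q\<in>prime_sets R (y * y). \<Prod>p\<in>Q. f p * (1 + f p) + f p)"
    by (intro sum.cong refl sum_pairs_union_eq) (auto simp: prime_sets_def)
  also have "\<dots> \<le> (\<Sum>Q\<in>prime_sets R (y * y). \<Prod>p\<in>Q. 2 / (real p - 2))"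
  proof (intro sum_mono prod_mono conjI)
    fix Q p assume "Q \<in> prime_sets R (y * y)" "p \<in> Q"
    then have "p \<noteq> 2" "prime p"
      using R by (auto simp: prime_sets_def)
    then have p: "p > 2"
      using prime_ge_2_nat[of p] by linarith
    show "0 \<le> f p * (1 + f p) + f p"
      by (simp add: f_def)
    have "f p * (1 + f p) + f p = (2 * real p + 1) / (real p * real p)"
      using p by (simp add: f_def field_simps)
    also have "\<dots> \<le> 2 / (real p - 2)"
      using p by (simp add: divide_simps) (simp add: algebra_simps)
    finally show "f p * (1 + f p) + f p \<le> 2 / (real p - 2)" .
  qed
  finally show ?thesis .
qed

section \<open>Unboundedness of \<open>P / totient P\<close>\<close>

text \<open>The witness is a factorial \<open>fact w\<close>: its ratio is the product of
  \<open>1 / (1 - 1 / p)\<close> over primes \<open>p \<le> w\<close>, which is at least the product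
  of \<open>1 + 1 / p\<close>. Expanding that product yields the reciprocals of all squarefree
  numbers up to \<open>w\<close>, hence at least \<open>harm w / 2\<close>.\<close>

lemma unbounded_ratio_totient: "\<exists>P\<ge>2. real P \<ge> C * real (totient P)"
proof -
  have "filterlim (\<lambda>n. ln (real n + 1)) at_top at_top"
    by real_asymp
  then have "eventually (\<lambda>n. ln (real n + 1) \<ge> 2 * C) at_top"
    by (simp add: filterlim_at_top)
  then obtain w where w: "w \<ge> 2" "ln (real w + 1) \<ge> 2 * C"
    by (auto simp: eventually_sequentially) (metis nle_le)
  define Pr where "Pr = prime_factors (fact w :: nat)"
  have Pr: "Pr = {p \<in> {2..w}. prime p}"
    unfolding Pr_def by (rule prime_factors_fact)
  have sub: "prime_sets {} w \<subseteq> Pow Pr"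
  proof
    fix Q assume Q: "Q \<in> prime_sets {} w"
    have "p \<le> w" "prime p" if "p \<in> Q" for p
    proof -
      have "p dvd \<Prod>Q"
        using Q that by (intro dvd_prodI) (auto simp: prime_sets_def)
      then have "p \<le> \<Prod>Q"
        using Q by (intro dvd_imp_le prod_primes_pos) (auto simp: prime_sets_def)
      with Q that show "p \<le> w" "prime p"
        by (auto simp: prime_sets_def)
    qed
    then show "Q \<in> Pow Pr"
      by (auto simp: Pr prime_ge_2_nat)
  qed
  have "2 * C \<le> harm w"
    using w(2) ln_le_harm[of w] by linarith
  also have "\<dots> \<le> 2 * (\<Sum>A\<in>prime_sets {} w. 1 / real (\<Prod>A))"
    using harm_le_sum_prime_sets[of "{}" w] by simp
  finally have "C \<le> (\<Sum>A\<in>prime_sets {} w. 1 / real (\<Prod>A))" by simp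
  also have "\<dots> \<le> (\<Sum>A\<in>Pow Pr. 1 / real (\<Prod>A))"
    using sub by (intro sum_mono2) (auto simp: Pr intro: prod_nonneg)
  also have "\<dots> = (\<Prod>p\<in>Pr. 1 / real p + 1)"
    by (subst prod_add) (auto simp: Pr prod_dividef)
  finally have C: "C \<le> (\<Prod>p\<in>Pr. 1 / real p + 1)" .
  have "C * real (totient (fact w)) = C * (real (fact w) * (\<Prod>p\<in>Pr. 1 - 1 / real p))"
    using totient_formula2[of "fact w"] by (simp add: Pr_def)
  also have "\<dots> \<le> (\<Prod>p\<in>Pr. 1 / real p + 1) * (real (fact w) * (\<Prod>p\<in>Pr. 1 - 1 / real p))"
    using C by (intro mult_right_mono mult_nonneg_nonneg prod_nonneg) (auto simp: Pr)
  also have "\<dots> = real (fact w) * (\<Prod>p\<in>Pr. (1 / real p + 1) * (1 - 1 / real p))"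
    by (simp add: prod.distrib)
  also have "\<dots> \<le> real (fact w) * 1"
    by (intro mult_left_mono prod_le_1) (auto simp: Pr algebra_simps intro: mult_ge1_I)
  finally have "C * real (totient (fact w)) \<le> real (fact w)" by simp
  moreover have "fact w \<ge> (2 :: nat)"
    using fact_mono_nat[OF w(1)] by simp
  ultimately show ?thesis by blast
qed

section \<open>Chebyshev's lower bound\<close>

text \<open>
  With \<open>a n k = 1 / (k * (n choose k))\<close>, Leibniz's harmonic triangle \<open>a n (k + 1) = a (n - 1) k - a n k\<close>
  shows that \<open>M * a n k\<close> is an integer.
\<close>

lemma times_binomial_dvd_common_multiple:
  fixes M :: nat
  assumes "\<And>m. 1 \<le> m \<Longrightarrow> m \<le> n \<Longrightarrow> m dvd M" "1 \<le> k" "k \<le> n"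
  shows "k * (n choose k) dvd M"
  using assms(2,1,3)
proof (induction k arbitrary: n rule: dec_induct)
  case base
  then show ?case by simp
next
  case (step k)
  then have "k * ((n - 1) choose k) dvd M" "k * (n choose k) dvd M"
    by auto
  then obtain s t where s: "M = k * ((n - 1) choose k) * s" and t: "M = k * (n choose k) * t"
    by (elim dvdE)
  define w where "w = Suc k * (n choose Suc k)"
  have w1: "w = n * ((n - 1) choose k)"
    unfolding w_def by (rule binomial_absorption)
  have w2: "w = (n - k) * (n choose k)"
    unfolding w1 by (rule binomial_absorb_comp[symmetric])
  have 1: "int k * (int w * int s) = int n * int M"
    unfolding s w1 by simp
  have 2: "int k * (int w * int t) = (int n - int k) * int M"
    unfolding t w2 using step by (simp add: of_nat_diff)
  \<comment> \<open>Subtracting the two relations leaves \<open>k * M\<close>: Leibniz's rule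
    cleared of denominators, with \<open>s - t\<close> as the quotient of \<open>M\<close> by
    \<open>w\<close>.\<close>
  have "int k * (int w * (int s - int t)) = int k * int M"
    using 1 2 by (simp add: algebra_simps)
  then have "int M = int w * (int s - int t)"
    using step by simp
  then have "int w dvd int M" by simp
  then have "w dvd M" by (simp only: int_dvd_int_iff)
  then show ?case
    by (simp only: w_def)
qed

text \<open>The witness is the least common multiple of 1 to \<open>n\<close>, written as the
  product over primes \<open>p \<le> n\<close> of the largest power of \<open>p\<close> not
  exceeding \<open>n\<close>; each factor is at most \<open>n\<close>.\<close>

lemma exists_small_common_multiple:
  assumes "n \<ge> 1"
  obtains M :: nat where "M > 0" "\<And>m. 1 \<le> m \<Longrightarrow> m \<le> n \<Longrightarrow> m dvd M"
    "M \<le> n ^ card {p. prime p \<and> p \<le> n}"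
proof -
  let ?Pr = "{p. prime p \<and> p \<le> n}"
  have "\<exists>e. p ^ e \<le> n \<and> (\<forall>j. p ^ j \<le> n \<longrightarrow> j \<le> e)" if "p \<in> ?Pr" for p
  proof (rule ex_has_greatest_nat[of "\<lambda>e. p ^ e \<le> n" 0 "\<lambda>e. e" "Suc n"])
    show "p ^ 0 \<le> n"
      using assms by simp
    show "\<forall>j. p ^ j \<le> n \<longrightarrow> j < Suc n"
    proof safe
      fix j assume "p ^ j \<le> n"
      have "j < 2 ^ j" by (rule less_exp)
      also have "2 ^ j \<le> p ^ j"
        using that by (intro power_mono) (auto simp: prime_ge_2_nat)
      finally show "j < Suc n"
        using \<open>p ^ j \<le> n\<close> by simp
    qed
  qed
  then obtain e where e: "\<And>p. p \<in> ?Pr \<Longrightarrow> p ^ e p \<le> n \<and> (\<forall>j. p ^ j \<le> n \<longrightarrow> j \<le> e p)"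
    by metis
  define M where "M = (\<Prod>p\<in>?Pr. p ^ e p)"
  have "m dvd M" if m: "1 \<le> m" "m \<le> n" for m
  proof -
    have "m = (\<Prod>p\<in>prime_factors m. p ^ multiplicity p m)"
      using prod_prime_factors[of m] m by simp
    also have "\<dots> dvd M"
      unfolding M_def
    proof (rule prod_dvd_prod_subset2)
      show "prime_factors m \<subseteq> ?Pr"
        using m by (auto dest!: dvd_imp_le simp: prime_factors_dvd)
      fix p assume p: "p \<in> prime_factors m"
      then have "p ^ multiplicity p m \<le> m"
        using m by (intro dvd_imp_le multiplicity_dvd) auto
      with p m \<open>prime_factors m \<subseteq> ?Pr\<close> have "multiplicity p m \<le> e p"
        using e[of p] by fastforce
      then show "p ^ multiplicity p m dvd p ^ e p"
        by (rule le_imp_power_dvd)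
    qed simp
    finally show ?thesis .
  qed
  moreover have "M > 0"
    unfolding M_def by (intro prod_pos) (auto intro: prime_gt_0_nat)
  moreover have "M \<le> (\<Prod>p\<in>?Pr. n)"
    unfolding M_def using e by (intro prod_mono) auto
  ultimately show ?thesis
    by (intro that[of M]) auto
qed

text \<open>With \<open>n = N div 2\<close>, the number
  \<open>n * (2 * n choose n) \<ge> 4 ^ n / 2\<close> divides a common multiple of size at most
  \<open>N ^ \<pi>\<close>; logarithms give the bound.\<close>

lemma chebyshev_lower_bound:
  assumes "N \<ge> 4"
  shows "real N / (4 * ln (real N)) \<le> real (card {p. prime p \<and> p \<le> N})"
proof -
  define n where "n = N div 2"
  define \<pi> where "\<pi> = card {p. prime p \<and> p \<le> N}"
  have n: "n \<ge> 1" "2 * n \<le> N" "N \<le> 2 * n + 1"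
    using assms by (auto simp: n_def)
  obtain M :: nat where M: "M > 0" "\<And>m. 1 \<le> m \<Longrightarrow> m \<le> N \<Longrightarrow> m dvd M" "M \<le> N ^ \<pi>"
    using exists_small_common_multiple[of N] assms unfolding \<pi>_def by auto
  have "n * ((2 * n) choose n) dvd M"
    using n M(2) by (intro times_binomial_dvd_common_multiple) auto
  with M have le: "n * ((2 * n) choose n) \<le> N ^ \<pi>"
    by (meson dvd_imp_le order_trans)
  have "4 ^ n / 2 = real n * (4 ^ n / (2 * real n))"
    using n by simp
  also have "\<dots> \<le> real n * real ((2 * n) choose n)"
    using n by (intro mult_left_mono central_binomial_lower_bound) auto
  also have "\<dots> \<le> real N ^ \<pi>"
    using le by (metis of_nat_le_iff of_nat_mult of_nat_power)
  finally have "4 ^ n / 2 \<le> real N ^ \<pi>" .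
  then have "ln (4 ^ n / 2) \<le> ln (real N ^ \<pi>)"
    using assms by (subst ln_le_cancel_iff) auto
  moreover have "ln (real N ^ \<pi>) = real \<pi> * ln (real N)"
    using assms by (simp add: ln_realpow)
  moreover have "ln (4 :: real) = 2 * ln 2"
    using ln_realpow[of 2 2] by simp
  then have "ln (4 ^ n / 2 :: real) = (2 * real n - 1) * ln 2"
    by (simp add: ln_div ln_realpow algebra_simps)
  ultimately have 1: "(2 * real n - 1) * ln 2 \<le> real \<pi> * ln (real N)"
    by simp
  \<comment> \<open>Here \<open>2 * n - 1 \<ge> N - 2 \<ge> N / 2\<close> because
    \<open>N \<ge> 4\<close>, and \<open>ln 2 \<ge> 2 / 3\<close>.\<close>
  have "real N / 2 * (1 / 2) \<le> (2 * real n - 1) * ln 2"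
    using n assms ln2_ge_two_thirds by (intro mult_mono) auto
  with 1 have "real N / 4 \<le> real \<pi> * ln (real N)" by simp
  moreover have "ln (real N) > 0"
    using assms by simp
  ultimately show ?thesis
    unfolding \<pi>_def by (simp add: field_simps)
qed

section \<open>Prime pairs with a given difference\<close>

lemma prime_diff_count_eq:
  assumes "x \<ge> 0"
  shows "prime_diff_count x d = card {p. prime p \<and> prime (p + d) \<and> p + d \<le> nat \<lfloor>x\<rfloor>}"
proof -
  have *: "real n \<le> x \<longleftrightarrow> n \<le> nat \<lfloor>x\<rfloor>" for n
    using assms by (simp add: le_nat_iff le_floor_iff)
  have "bij_betw (\<lambda>p. (p, p + d)) {p. prime p \<and> prime (p + d) \<and> p + d \<le> nat \<lfloor>x\<rfloor>}
     {(p, p'). prime p \<and> prime p' \<and> real p \<le> x \<and> real p' \<le> x \<and> int p' - int p = int d}"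
  proof (rule bij_betwI[of _ _ _ fst], goal_cases)
    case 2
    show ?case
    proof
      fix t assume "t \<in> {(p, p'). prime p \<and> prime p' \<and> real p \<le> x \<and> real p' \<le> x \<and> int p' - int p = int d}"
      then obtain p q where t: "t = (p, q)" "prime p" "prime q" "real q \<le> x" "int q - int p = int d"
        by auto
      moreover from t have "q = p + d" by linarith
      ultimately show "fst t \<in> {p. prime p \<and> prime (p + d) \<and> p + d \<le> nat \<lfloor>x\<rfloor>}"
        using *[of q] by auto
    qed
  qed (auto simp: *)
  then show ?thesis
    unfolding prime_diff_count_def by (simp add: bij_betw_same_card)
qed

lemma card_multiples_le:
  assumes "P > 0"
  shows "card {e. 0 < e \<and> e \<le> N \<and> P dvd e} \<le> N div P"
proof -
  have "{e. 0 < e \<and> e \<le> N \<and> P dvd e} \<subseteq> (\<lambda>j. P * j) ` {1..N div P}"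
    using assms by (auto simp: image_iff elim!: dvdE) 
      (metis One_nat_def Suc_leI atLeastAtMost_iff div_le_mono nonzero_mult_div_cancel_left not_gr_zero)
  then have "card {e. 0 < e \<and> e \<le> N \<and> P dvd e} \<le> card {1..N div P}"
    by (rule surj_card_le[rotated]) simp
  then show ?thesis by simp
qed

section \<open>Pigeonhole bound for differences divisible by \<open>P\<close>\<close>

text \<open>\<open>M\<close> bounds the number of representations of each difference, so congruent
  pairs number at most \<open>N\<close> on the diagonal plus twice \<open>M\<close> for each
  multiple of \<open>P\<close> up to \<open>N\<close>.\<close>

lemma prime_pairs_pigeonhole:
  assumes "P \<ge> 2" "x \<ge> 0" and N: "N = nat \<lfloor>x\<rfloor>"
    and M: "\<And>e. e > 0 \<Longrightarrow> prime_diff_count x e \<le> M"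
  shows "(real (card {p. prime p \<and> p \<le> N \<and> coprime p P}))\<^sup>2
           \<le> real (totient P) * (real N + 2 * (real N / real P) * real M)"
proof -
  define S where "S = {p. prime p \<and> p \<le> N \<and> coprime p P}"
  define T where "T = {(p, q) \<in> S \<times> S. p mod P = q mod P}"
  define T' where "T' = {(p, q) \<in> T. p < q}"
  define E where "E = {e. 0 < e \<and> e \<le> N \<and> P dvd e}"
  have finS: "finite S"
    by (rule finite_subset[of _ "{..N}"]) (auto simp: S_def)
  have finT: "finite T"
    by (rule finite_subset[of _ "S \<times> S"]) (auto simp: T_def finS)
  then have finT': "finite T'"
    by (rule finite_subset[rotated]) (auto simp: T'_def)
  \<comment> \<open>Totatives are positive, so the residue 0 must be ruled out; it is not coprime to
    \<open>P\<close> since \<open>P \<ge> 2\<close>.\<close>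
  have modS: "p mod P \<in> totatives P" if "p \<in> S" for p
  proof -
    have "coprime (p mod P) P"
      using that \<open>P \<ge> 2\<close> by (simp add: S_def coprime_mod_left_iff)
    moreover have "p mod P \<noteq> 0"
      using calculation \<open>P \<ge> 2\<close> by (intro notI) simp
    moreover have "p mod P \<le> P"
      using \<open>P \<ge> 2\<close> by (simp add: less_imp_le)
    ultimately show ?thesis
      by (simp add: in_totatives_iff)
  qed
  have "card S = (\<Sum>a\<in>totatives P. card {p \<in> S. p mod P = a})"
    using sum.group[OF finS finite_totatives, of "\<lambda>p. p mod P" P "\<lambda>_. 1 :: nat"] modS by (simp add: image_subset_iff)
  then have "(real (card S))\<^sup>2 = (\<Sum>a\<in>totatives P. 1 * real (card {p \<in> S. p mod P = a}))\<^sup>2"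
    by simp
  also have "\<dots> \<le> (\<Sum>a\<in>totatives P. 1\<^sup>2) * (\<Sum>a\<in>totatives P. (real (card {p \<in> S. p mod P = a}))\<^sup>2)"
    by (rule Cauchy_Schwarz_ineq_sum)
  also have "\<dots> = real (totient P) * (\<Sum>a\<in>totatives P. (real (card {p \<in> S. p mod P = a}))\<^sup>2)"
    by (simp add: totient_def)
  also have "(\<Sum>a\<in>totatives P. (real (card {p \<in> S. p mod P = a}))\<^sup>2) = real (card T)"
  proof -
    have "(\<lambda>(p, q). p mod P) ` T \<subseteq> totatives P"
      using modS by (auto simp: T_def)
    from sum.group[OF finT finite_totatives this, of "\<lambda>_. 1 :: nat"]
    have "card T = (\<Sum>a\<in>totatives P. card {t \<in> T. (\<lambda>(p, q). p mod P) t = a})"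
      by simp
    also have "\<dots> = (\<Sum>a\<in>totatives P. card ({p \<in> S. p mod P = a} \<times> {p \<in> S. p mod P = a}))"
      by (intro sum.cong refl arg_cong[where f = card]) (auto simp: T_def)
    finally show ?thesis
      by (simp add: card_cartesian_product power2_eq_square)
  qed
  finally have 1: "(real (card S))\<^sup>2 \<le> real (totient P) * real (card T)" .
  \<comment> \<open>A congruent pair is diagonal, increasing, or the mirror image of an increasing
    one.\<close>
  have "T \<subseteq> (\<lambda>p. (p, p)) ` S \<union> (T' \<union> prod.swap ` T')"
    by (force simp: T_def T'_def image_iff)
  then have "card T \<le> card ((\<lambda>p. (p, p)) ` S \<union> (T' \<union> prod.swap ` T'))"
    using finS finT' by (intro card_mono) auto
  also have "\<dots> \<le> card S + (card T' + card T')"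
    using finS finT' by (intro order_trans[OF card_Un_le] add_mono card_image_le order_trans[OF card_Un_le]) auto
  also have "card S \<le> N"
  proof -
    have "S \<subseteq> {1..N}"
      by (auto simp: S_def Suc_le_eq prime_gt_0_nat)
    then have "card S \<le> card {1..N}"
      by (intro card_mono) auto
    then show ?thesis by simp
  qed
  finally have 2: "card T \<le> N + 2 * card T'" by simp
  have "T' \<subseteq> (\<Union>e\<in>E. (\<lambda>p. (p, p + e)) ` {p. prime p \<and> prime (p + e) \<and> p + e \<le> N})"
  proof
    fix t assume "t \<in> T'"
    then obtain p q where t: "t = (p, q)" and pq: "p \<in> S" "q \<in> S" "p mod P = q mod P" "p < q"
      by (auto simp: T'_def T_def)
    from pq have "P dvd q - p"
      by (metis less_imp_le mod_eq_dvd_iff_nat)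
    with pq t show "t \<in> (\<Union>e\<in>E. (\<lambda>p. (p, p + e)) ` {p. prime p \<and> prime (p + e) \<and> p + e \<le> N})"
      by (intro UN_I[of "q - p"]) (auto simp: E_def S_def)
  qed
  then have "card T' \<le> card (\<Union>e\<in>E. (\<lambda>p. (p, p + e)) ` {p. prime p \<and> prime (p + e) \<and> p + e \<le> N})"
    by (rule card_mono[rotated]) (auto simp: E_def intro!: finite_imageI intro: finite_subset[of _ "{..N}"])
  also have "\<dots> \<le> (\<Sum>e\<in>E. card ((\<lambda>p. (p, p + e)) ` {p. prime p \<and> prime (p + e) \<and> p + e \<le> N}))"
    by (rule card_UN_le) (auto simp: E_def)
  also have "\<dots> \<le> (\<Sum>e\<in>E. M)"
  proof (rule sum_mono)
    fix e assume "e \<in> E"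
    have "card ((\<lambda>p. (p, p + e)) ` {p. prime p \<and> prime (p + e) \<and> p + e \<le> N})
        = card {p. prime p \<and> prime (p + e) \<and> p + e \<le> N}"
      by (intro card_image inj_onI) auto
    also have "\<dots> = prime_diff_count x e"
      using \<open>x \<ge> 0\<close> by (simp add: prime_diff_count_eq N)
    also have "\<dots> \<le> M"
      using \<open>e \<in> E\<close> by (intro M) (auto simp: E_def)
    finally show "card ((\<lambda>p. (p, p + e)) ` {p. prime p \<and> prime (p + e) \<and> p + e \<le> N}) \<le> M" .
  qed
  also have "\<dots> \<le> (N div P) * M"
    using card_multiples_le[of P N] \<open>P \<ge> 2\<close> by (simp add: E_def)
  finally have "real (card T') \<le> real (N div P) * real M"
    by (metis of_nat_le_iff of_nat_mult)
  also have "\<dots> \<le> real N / real P * real M"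
    by (intro mult_right_mono of_nat_div_le_of_nat) auto
  finally have "real (card T) \<le> real N + 2 * (real N / real P) * real M"
    using 2 by linarith
  with 1 show ?thesis
    unfolding S_def by (meson mult_left_mono of_nat_0_le_iff order_trans)
qed

section \<open>Sieve bound for differences with few prime factors\<close>

lemma prime_pairs_upper_bound:
  assumes d: "d > 0" "card (prime_factors d) \<le> k" and N: "N \<ge> 2"
  shows "real (card {p. prime p \<and> prime (p + d) \<and> p + d \<le> N})
           \<le> 4 ^ (k + 7) * (real N / (ln (real N))\<^sup>2) + 2 * sqrt (real N)"
proof -
  \<comment> \<open>\<open>y\<close> is the integer part of the 16th root of \<open>N\<close>. With
    \<open>z = y * y\<close> the sieve error is at most \<open>z ^ 4 = y ^ 8 \<le> sqrt N\<close>,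
    while \<open>ln (y + 1)\<close> is still at least \<open>ln N / 16\<close>.\<close>
  have "\<exists>y. y ^ 16 \<le> N \<and> (\<forall>j. j ^ 16 \<le> N \<longrightarrow> j \<le> y)"
  proof (rule ex_has_greatest_nat[of "\<lambda>y. y ^ 16 \<le> N" 0 "\<lambda>y. y" "Suc N"])
    show "\<forall>j. j ^ 16 \<le> N \<longrightarrow> j < Suc N"
    proof safe
      fix j assume "j ^ 16 \<le> N"
      moreover have "j \<le> j ^ 16"
        by (cases "j = 0") (auto intro: self_le_power)
      ultimately show "j < Suc N" by simp
    qed
  qed simp
  then obtain y where y: "y ^ 16 \<le> N" "\<And>j. j ^ 16 \<le> N \<Longrightarrow> j \<le> y" by blast
  have "y \<ge> 1"
    using y(2)[of 1] N by simp
  have "N < (y + 1) ^ 16"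
    using y(2)[of "y + 1"] by (auto simp: not_le[symmetric])
  then have "real N < (real y + 1) ^ 16"
    by (metis of_nat_1 of_nat_add of_nat_less_iff of_nat_power)
  then have "ln (real N) \<le> ln ((real y + 1) ^ 16)"
    using N by (subst ln_le_cancel_iff) auto
  then have ln_y: "ln (real N) \<le> 16 * ln (real y + 1)"
    by (simp add: ln_realpow)
  have "(real y ^ 8)\<^sup>2 \<le> real N"
    using y(1) by (simp flip: power_mult of_nat_power)
  then have y8: "real y ^ 8 \<le> sqrt (real N)"
    by (rule real_le_rsqrt)
  define z where "z = y * y"
  have z: "real z ^ 4 = real y ^ 8"
    by (simp add: z_def flip: power2_eq_square power_mult)
  have z_le: "real z \<le> sqrt (real N)"
  proof -
    have "z \<ge> 1"
      using \<open>y \<ge> 1\<close> by (simp add: z_def)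
    then have "real z \<le> real z ^ 4"
      by (intro self_le_power) auto
    with y8 z show ?thesis by linarith
  qed

  \<comment> \<open>Excluding 2 and 3 keeps the weights bounded by 1; excluding the primes dividing
    \<open>d\<close> keeps the two residue classes distinct.\<close>
  define R where "R = {2, 3} \<union> prime_factors d"
  define \<Q> where "\<Q> = prime_sets R z"
  define L where "L = (\<Sum>Q\<in>\<Q>. \<Prod>p\<in>Q. 2 / (real p - 2))"
  have finR: "finite R" by (simp add: R_def)
  have "card R \<le> card {2, 3 :: nat} + card (prime_factors d)"
    unfolding R_def by (rule card_Un_le)
  then have cardR: "card R \<le> k + 2"
    using d by simp
  have Q: "prime p \<and> p > 3 \<and> \<not> p dvd d \<and> p \<le> z" if "Q \<in> \<Q>" "p \<in> Q" for Q p
  proof -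
    have p: "prime p" "p \<notin> R" and Q: "finite Q" "\<Prod>Q \<le> z" "\<And>p. p \<in> Q \<Longrightarrow> prime p"
      using that by (auto simp: \<Q>_def prime_sets_def)
    have "p \<le> \<Prod>Q"
      using Q that by (intro dvd_imp_le dvd_prodI prod_primes_pos) auto
    moreover have "p \<noteq> 2" "p \<noteq> 3" "\<not> p dvd d"
      using p d by (auto simp: R_def prime_factors_dvd)
    moreover have "p \<ge> 2"
      using p prime_ge_2_nat by blast
    ultimately show ?thesis
      using p Q by linarith
  qed

  \<comment> \<open>The exponent collects \<open>16 * 2 * 2 ^ (k + 2)\<close>.\<close>
  have S: "ln (real N) \<le> 2 ^ (k + 7) * (\<Sum>A\<in>prime_sets R y. 1 / real (\<Prod>A))"
  proof -
    have "ln (real N) \<le> 16 * harm y"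
      using ln_y ln_le_harm[of y] by linarith
    also have "\<dots> \<le> 16 * (2 * 2 ^ card R * (\<Sum>A\<in>prime_sets R y. 1 / real (\<Prod>A)))"
      using harm_le_sum_prime_sets[OF finR, of y] by simp
    also have "\<dots> \<le> 16 * (2 * 2 ^ (k + 2) * (\<Sum>A\<in>prime_sets R y. 1 / real (\<Prod>A)))"
      using cardR by (intro mult_left_mono mult_right_mono power_increasing sum_nonneg) (auto intro!: prod_nonneg)
    finally show ?thesis
      by (simp add: power_add)
  qed
  have lnN: "ln (real N) > 0"
    using N by simp
  have "(ln (real N))\<^sup>2 \<le> (2 ^ (k + 7) * (\<Sum>A\<in>prime_sets R y. 1 / real (\<Prod>A)))\<^sup>2"
    using S lnN by (intro power_mono) auto
  also have "\<dots> = 4 ^ (k + 7) * (\<Sum>A\<in>prime_sets R y. 1 / real (\<Prod>A))\<^sup>2"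
  proof -
    have "(2 ^ (k + 7))\<^sup>2 = ((2 * 2) ^ (k + 7) :: real)"
      by (simp only: power2_eq_square power_mult_distrib)
    then show ?thesis
      by (simp add: power_mult_distrib)
  qed
  also have "\<dots> \<le> 4 ^ (k + 7) * L"
    unfolding L_def \<Q>_def z_def
    by (intro mult_left_mono sum_prime_sets_square_le) (auto simp: R_def)
  finally have L: "(ln (real N))\<^sup>2 \<le> 4 ^ (k + 7) * L" .
  \<comment> \<open>The empty set alone contributes 1.\<close>
  have "L \<ge> 1"
  proof -
    have "{} \<in> \<Q>"
      using \<open>y \<ge> 1\<close> by (auto simp: \<Q>_def prime_sets_def z_def)
    moreover have "finite \<Q>"
      by (simp add: \<Q>_def finite_prime_sets)
    moreover have "(\<Prod>p\<in>Q. 2 / (real p - 2)) \<ge> 0" if "Q \<in> \<Q>" for Q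
      using Q[OF that] by (intro prod_nonneg) force
    ultimately have "(\<Prod>p\<in>{}. 2 / (real p - 2)) \<le> L"
      unfolding L_def by (intro member_le_sum) auto
    then show ?thesis by simp
  qed

  \<comment> \<open>A prime above \<open>z\<close> is divisible by no sieving prime, all of which
    are at most \<open>z\<close>. The discarded primes number at most \<open>z \<le> sqrt N\<close>,
    which accounts for the second square root in the bound.\<close>
  define A where "A = {p. prime p \<and> prime (p + d) \<and> p + d \<le> N \<and> p > z}"
  have "real (card A) * L\<^sup>2 \<le> real N * L + (real (card \<Q>) * real z)\<^sup>2"
  proof (rule selberg_sieve_two_classes[of \<Q> z d])
    show "finite \<Q>"
      by (simp add: \<Q>_def finite_prime_sets)
    show "finite Q \<and> \<Prod>Q \<le> z" if "Q \<in> \<Q>" for Q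
      using that by (simp add: \<Q>_def prime_sets_def)
    show "prime p \<and> p > 3 \<and> \<not> p dvd d" if "Q \<in> \<Q>" "p \<in> Q" for Q p
      using Q[OF that] by simp
    show "A \<subseteq> {..<N}"
      using d by (auto simp: A_def)
    fix Q p n assume *: "Q \<in> \<Q>" "p \<in> Q" "n \<in> A"
    then have p: "prime p" "p \<le> z" and n: "prime n" "prime (n + d)" "n > z"
      using Q[of Q p] by (auto simp: A_def)
    show "\<not> p dvd n \<and> \<not> p dvd n + d"
      using p n primes_dvd_imp_eq[of p n] primes_dvd_imp_eq[of p "n + d"] by auto
  qed (simp add: L_def)
  also have "(real (card \<Q>) * real z)\<^sup>2 \<le> (real z * real z)\<^sup>2"
    by (intro power_mono mult_right_mono) (auto simp: \<Q>_def card_prime_sets_le)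
  also have "(real z * real z)\<^sup>2 = real z ^ 4"
    by (simp add: power_mult_distrib flip: power_add)
  also have "\<dots> \<le> sqrt (real N)"
    using y8 z by simp
  also have "\<dots> \<le> sqrt (real N) * L\<^sup>2"
    using \<open>L \<ge> 1\<close> by (simp add: mult_le_cancel_left1)
  finally have "real (card A) * L\<^sup>2 \<le> (real N / L + sqrt (real N)) * L\<^sup>2"
    using \<open>L \<ge> 1\<close> by (simp add: algebra_simps power2_eq_square)
  then have "real (card A) \<le> real N / L + sqrt (real N)"
    using \<open>L \<ge> 1\<close> by (simp add: mult_le_cancel_right)
  moreover have "real N / L \<le> 4 ^ (k + 7) * (real N / (ln (real N))\<^sup>2)"
    using L \<open>L \<ge> 1\<close> lnN mult_left_mono[OF L, of "real N"] by (simp add: field_simps)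
  moreover have "card {p. prime p \<and> prime (p + d) \<and> p + d \<le> N} \<le> card A + z"
  proof -
    have fin: "finite A"
      by (rule finite_subset[of _ "{..N}"]) (auto simp: A_def)
    have "{p. prime p \<and> prime (p + d) \<and> p + d \<le> N} \<subseteq> A \<union> {1..z}"
      by (auto simp: A_def Suc_le_eq prime_gt_0_nat)
    then have "card {p. prime p \<and> prime (p + d) \<and> p + d \<le> N} \<le> card (A \<union> {1..z})"
      using fin by (intro card_mono) auto
    also have "\<dots> \<le> card A + card {1..z}"
      by (rule card_Un_le)
    finally show ?thesis by simp
  qed
  ultimately show ?thesis
    using z_le by linarith
qed

section \<open>Comparison of the two bounds\<close>

lemma champion_many_prime_factors:
  "\<exists>N0. \<forall>x d. nat \<lfloor>x\<rfloor> \<ge> N0 \<longrightarrow> prime_difference_champion x d \<longrightarrow> card (prime_factors d) > k"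
proof -
  define C :: real where "C = 4 ^ (k + 7)"
  have C: "C > 0" by (simp add: C_def)
  \<comment> \<open>The 128 is \<open>8\<^sup>2\<close> from the squared prime count times the 2 for
    unordered pairs; \<open>C + 1\<close> instead of \<open>C\<close> leaves a surplus
    \<open>N / (ln N)\<^sup>2\<close> over the sieve bound.\<close>
  obtain P where P: "P \<ge> 2" "real P \<ge> 128 * (C + 1) * real (totient P)"
    using unbounded_ratio_totient by blast
  \<comment> \<open>The first limit lets half of Chebyshev's count absorb the primes dividing
    \<open>P\<close>; the second contradicts the final inequality.\<close>
  have "filterlim (\<lambda>N. real N / (8 * ln (real N))) at_top at_top"
    "filterlim (\<lambda>N. real N / (ln (real N))\<^sup>2 - 2 * sqrt (real N)) at_top at_top"
    by real_asymp+
  then have "eventually (\<lambda>N. real P < real N / (8 * ln (real N))) at_top"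
    "eventually (\<lambda>N. real P < real N / (ln (real N))\<^sup>2 - 2 * sqrt (real N)) at_top"
    by (simp_all add: filterlim_at_top_dense)
  from eventually_conj[OF this] obtain N0 where N0: "\<And>N. N \<ge> N0 \<Longrightarrow> real P < real N / (8 * ln (real N))"
    "\<And>N. N \<ge> N0 \<Longrightarrow> real P < real N / (ln (real N))\<^sup>2 - 2 * sqrt (real N)"
    unfolding eventually_sequentially by blast
  have "card (prime_factors d) > k"
    if N: "nat \<lfloor>x\<rfloor> \<ge> max 4 N0" and champ: "prime_difference_champion x d" for x d
  proof (rule ccontr)
    assume "\<not> card (prime_factors d) > k"
    define N where "N = nat \<lfloor>x\<rfloor>"
    define M where "M = prime_diff_count x d"
    have N4: "N \<ge> 4" "N \<ge> N0"
      using N by (auto simp: N_def)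
    have x: "x \<ge> 0"
      using N4 unfolding N_def by linarith
    have lnN: "ln (real N) > 0"
      using N4 by simp
    have M: "real M \<le> C * (real N / (ln (real N))\<^sup>2) + 2 * sqrt (real N)"
      using prime_pairs_upper_bound[of d k N] champ N4 \<open>\<not> card (prime_factors d) > k\<close>
      unfolding C_def M_def by (simp add: prime_diff_count_eq[OF x] N_def prime_difference_champion_def)
    let ?S = "{p. prime p \<and> p \<le> N \<and> coprime p P}"
    have "{p. prime p \<and> p \<le> N} \<subseteq> ?S \<union> {1..P}"
    proof safe
      fix p assume p: "prime p" "p \<le> N" "p \<notin> {1..P}"
      then have "\<not> p dvd P"
        using P(1) dvd_imp_le[of p P] prime_gt_0_nat[of p] by auto
      with p show "coprime p P"
        by (simp add: prime_imp_coprime)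
    qed
    then have "card {p. prime p \<and> p \<le> N} \<le> card (?S \<union> {1..P})"
      by (intro card_mono) auto
    also have "\<dots> \<le> card ?S + card {1..P}"
      by (rule card_Un_le)
    finally have "real (card {p. prime p \<and> p \<le> N}) \<le> real (card ?S) + real P"
      by simp
    moreover have "real N / (4 * ln (real N)) \<le> real (card {p. prime p \<and> p \<le> N})"
      using N4 by (intro chebyshev_lower_bound)
    moreover have "real N / (4 * ln (real N)) = 2 * (real N / (8 * ln (real N)))"
      by simp
    ultimately have S: "real N / (8 * ln (real N)) \<le> real (card ?S)"
      using N0(1)[OF N4(2)] by linarith
    have "(real N / (8 * ln (real N)))\<^sup>2 \<le> (real (card ?S))\<^sup>2"
      using S lnN by (intro power_mono) auto
    \<comment> \<open>As \<open>d\<close> is a champion, its count \<open>M\<close> bounds the count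
      of every difference.\<close>
    also have "\<dots> \<le> real (totient P) * (real N + 2 * (real N / real P) * real M)"
      using P(1) x N_def champ
      by (intro prime_pairs_pigeonhole) (auto simp: M_def prime_difference_champion_def)
    also have "\<dots> \<le> (real P / (128 * (C + 1))) * (real N + 2 * (real N / real P) * real M)"
      using P C by (intro mult_right_mono) (auto simp: field_simps)
    also have "\<dots> = real N / (64 * (C + 1)) * (real P / 2 + real M)"
    proof -
      have "real P / (128 * D) * (real N + 2 * (real N / real P) * real M) = real N / (64 * D) * (real P / 2 + real M)"
        if "D > 0" for D
        using that P(1) by (simp add: field_simps)
      from this[of "C + 1"] C show ?thesis by simp
    qed
    also have "(real N / (8 * ln (real N)))\<^sup>2 = real N / (64 * (C + 1)) * ((C + 1) * (real N / (ln (real N))\<^sup>2))"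
    proof -
      have "(real N / (8 * ln (real N)))\<^sup>2 = real N / (64 * D) * (D * (real N / (ln (real N))\<^sup>2))"
        if "D > 0" for D
        using that by (simp add: power_divide power_mult_distrib) (simp add: power2_eq_square)
      from this[of "C + 1"] C show ?thesis by simp
    qed
    finally have "(C + 1) * (real N / (ln (real N))\<^sup>2) \<le> real P / 2 + real M"
      using C N4 by (subst (asm) mult_le_cancel_left_pos) auto
    \<comment> \<open>The terms \<open>C * (N / (ln N)\<^sup>2)\<close> cancel and only the surplus
      remains on the left.\<close>
    with M have "real N / (ln (real N))\<^sup>2 \<le> real P / 2 + 2 * sqrt (real N)"
      by (simp only: distrib_right mult_1_left)
    with N0(2)[OF N4(2)] show False by linarith
  qed
  then show ?thesis by blast
qed

theorem theorem2:
  fixes dstar :: "real \<Rightarrow> nat"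
  assumes "\<And>x. x \<ge> 2 \<Longrightarrow> prime_difference_champion x (dstar x)"
  shows "filterlim dstar at_top at_top \<and>
         filterlim (\<lambda>x. card (prime_factors (dstar x))) at_top at_top"
proof
  show lim: "filterlim (\<lambda>x. card (prime_factors (dstar x))) at_top at_top"
    unfolding filterlim_at_top
  proof
    fix k
    obtain N0 where N0: "\<And>x d. nat \<lfloor>x\<rfloor> \<ge> N0 \<Longrightarrow> prime_difference_champion x d \<Longrightarrow> card (prime_factors d) > k"
      using champion_many_prime_factors by blast
    show "eventually (\<lambda>x. k \<le> card (prime_factors (dstar x))) at_top"
      using eventually_ge_at_top[of "max 2 (real N0)"]
    proof eventually_elim
      case (elim x)
      then have "nat \<lfloor>x\<rfloor> \<ge> N0"
        by (simp add: le_nat_floor)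
      then show ?case
        using N0[of x "dstar x"] assms[of x] elim by simp
    qed
  qed
  \<comment> \<open>A positive integer has at most as many prime factors as its size, so this limit
    follows from the other.\<close>
  show "filterlim dstar at_top at_top"
  proof (rule filterlim_at_top_mono[OF lim])
    show "eventually (\<lambda>x. card (prime_factors (dstar x)) \<le> dstar x) at_top"
      using eventually_ge_at_top[of 2]
    proof eventually_elim
      case (elim x)
      then have "dstar x > 0"
        using assms by (auto simp: prime_difference_champion_def)
      then have "prime_factors (dstar x) \<subseteq> {1..dstar x}"
        by (auto simp: prime_factors_dvd Suc_le_eq prime_gt_0_nat dest: dvd_imp_le)
      then have "card (prime_factors (dstar x)) \<le> card {1..dstar x}"
        by (intro card_mono) auto
      then show ?case by simp
    qed
  qed
qed

end
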